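(* There exist infinitely many (pairwise non-isomorphic) $2$-connected graphs $G$ with $\Delta(G) = 5$ and $\chi_c'(G) = 5+\frac{2}{3}$.
   Context: Graphs are finite and simple (no loops, no parallel edges). $\Delta(G)$ denotes the maximum degree of $G$. For a real number $r$, a circular $r$-edge-colouring of $G$ is a map $c$ assigning to each edge of $G$ a real number in $[0,r)$ such that any two distinct edges $e,f$ sharing an end-vertex satisfy $1\le |c(e)-c(f)|\le r-1$. The circular chromatic index $\chi_c'(G)$ is the infimum (attained for finite graphs) of all $r$ such that $G$ admits a circular $r$-edge-colouring. "$2$-connected" refers to vertex connectivity. *)

theory Defs
  imports Complex_Main
begin

record 'a graph =
  verts :: "'a set"
  edges :: "'a set set"

definition simple_graph :: "'a graph \<Rightarrow> bool" where
  "simple_graph G \<longleftrightarrow> finite (verts G) \<and> (\<forall>e\<in>edges G. e \<subseteq> verts G \<and> card e = 2)"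

definition graph_iso :: "'a graph \<Rightarrow> 'b graph \<Rightarrow> bool" where
  "graph_iso G H \<longleftrightarrow> (\<exists>f. bij_betw f (verts G) (verts H) \<and>
     (\<forall>u\<in>verts G. \<forall>v\<in>verts G. {u, v} \<in> edges G \<longleftrightarrow> {f u, f v} \<in> edges H))"

definition degree :: "'a graph \<Rightarrow> 'a \<Rightarrow> nat" where
  "degree G v = card {e \<in> edges G. v \<in> e}"

(* Unspecified for the graph without vertices. *)
definition max_degree :: "'a graph \<Rightarrow> nat" where
  "max_degree G = Max (degree G ` verts G)"

definition delete_verts :: "'a graph \<Rightarrow> 'a set \<Rightarrow> 'a graph" where
  "delete_verts G X = \<lparr>verts = verts G - X, edges = {e \<in> edges G. e \<inter> X = {}}\<rparr>"

definition connected_graph :: "'a graph \<Rightarrow> bool" where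
  "connected_graph G \<longleftrightarrow> verts G \<noteq> {} \<and>
     (\<forall>u\<in>verts G. \<forall>v\<in>verts G. (u, v) \<in> {(x, y). {x, y} \<in> edges G}\<^sup>*)"

(* Vertex connectivity; X = {} gives connectedness of G itself. *)
definition k_connected :: "nat \<Rightarrow> 'a graph \<Rightarrow> bool" where
  "k_connected k G \<longleftrightarrow> k < card (verts G) \<and>
     (\<forall>X\<subseteq>verts G. card X < k \<longrightarrow> connected_graph (delete_verts G X))"

definition circular_edge_colouring :: "'a graph \<Rightarrow> real \<Rightarrow> ('a set \<Rightarrow> real) \<Rightarrow> bool" where
  "circular_edge_colouring G r c \<longleftrightarrow>
     (\<forall>e\<in>edges G. c e \<in> {0..<r}) \<and>
     (\<forall>e\<in>edges G. \<forall>f\<in>edges G. e \<noteq> f \<and> e \<inter> f \<noteq> {} \<longrightarrow>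
        1 \<le> \<bar>c e - c f\<bar> \<and> \<bar>c e - c f\<bar> \<le> r - 1)"

(* For a finite graph with at least one edge this set of reals is nonempty and
   bounded below by 0; for an edgeless graph it is all of the reals, so that the
   value is unspecified. *)
definition circular_chromatic_index :: "'a graph \<Rightarrow> real" where
  "circular_chromatic_index G = Inf {r. \<exists>c. circular_edge_colouring G r c}"

end

theory Submission
  imports Defs
begin

text \<open>
  Two blocks with seven vertices and sixteen edges are joined by the edges \<open>a = {6, 7}\<close> and
  \<open>b = {4, 13}\<close>; the vertices 0 and 13, which still have degree 4, are joined by a path whose
  length is the parameter of the family. Rounding \<open>3 c\<close> down turns a circular
  \<open>r\<close>-edge-colouring \<open>c\<close> with \<open>r \<le> 17/3\<close> into a colouring by residues modulo 17 in which
  adjacent edges have a difference in \<open>{3..14}\<close>. A case analysis of such colourings, left to a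
  proof-producing SAT solver, shows that the difference of the residues of \<open>b\<close> and \<open>a\<close> is none
  of \<open>1, 3, 5, 8\<close> in the first block and neither \<open>0\<close> nor \<open>6\<close> in the second, up to sign; so it
  lies in \<open>D = {2, 4, 7, 10, 13, 15}\<close>.

  Now let \<open>r < 17/3\<close> and let \<open>y\<close> be the clockwise distance from \<open>c a\<close> to \<open>c b\<close>. The origin and
  the rounding offset are free, so \<open>3 y\<close> rounded down and rounded up are both in \<open>D\<close>. As \<open>D\<close>
  contains no two consecutive residues, \<open>3 y\<close> is an integer \<open>m\<close>. Measured from \<open>b\<close>, the distance is
  \<open>r - y\<close>, and \<open>3 (r - y)\<close> rounds down to \<open>16 - m\<close>, which is never in \<open>D\<close> when \<open>m\<close> is.
\<close>

section \<open>Residues modulo 17 and their propositional encoding\<close>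

definition far :: "int \<Rightarrow> int \<Rightarrow> bool" where
  "far x y \<longleftrightarrow> (x - y) mod 17 \<in> {3..14}"

lemma far_uminus: "far x y \<Longrightarrow> far (- x) (- y)"
  using zmod_zminus1_eq_if[of "x - y" 17] by (auto simp: far_def split: if_splits)

lemma far_sym: "far x y \<Longrightarrow> far y x"
  using zmod_zminus1_eq_if[of "x - y" 17] by (auto simp: far_def split: if_splits)

lemma mod17_diff:
  fixes x y :: int
  assumes "0 \<le> x" "x < 17" "0 \<le> y" "y < 17"
  shows "(x - y) mod 17 = (if y \<le> x then x - y else x - y + 17)"
  using assms mod_pos_pos_trivial[of "x - y" 17] mod_pos_pos_trivial[of "x - y + 17" 17] by auto

lemma mod17_add:
  fixes x :: int
  assumes "0 \<le> x" "x < 17" "0 \<le> k" "k < 17"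
  shows "(x + k) mod 17 = (if x + k < 17 then x + k else x + k - 17)"
  using assms mod_pos_pos_trivial[of "x + k" 17] mod_pos_pos_trivial[of "x + k - 17" 17] by auto

text \<open>An arc of three residues starts at each \<open>h i\<close>. By \<open>far\<close> these
  arcs are disjoint, by the last hypothesis they miss \<open>B\<close>, and everything has to fit
  into 17 residues.\<close>

lemma packing:
  fixes h :: "'a \<Rightarrow> int"
  assumes fin: "finite I"
    and far: "\<And>i j. i \<in> I \<Longrightarrow> j \<in> I \<Longrightarrow> i \<noteq> j \<Longrightarrow> far (h i) (h j)"
    and B: "B \<subseteq> {0..<17}" "\<And>i b. i \<in> I \<Longrightarrow> b \<in> B \<Longrightarrow> 3 \<le> (b - h i) mod 17"
  shows "3 * card I + card B \<le> 17"
proof -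
  let ?f = "\<lambda>(i, j). (h i + j) mod 17"
  let ?P = "I \<times> {0..<3::int}"
  have "inj_on ?f ?P"
  proof (rule inj_onI, clarsimp)
    fix i j i' j'
    assume i: "i \<in> I" "i' \<in> I" and j: "0 \<le> j" "j < 3" "0 \<le> j'" "j' < 3"
      and eq: "(h i + j) mod 17 = (h i' + j') mod 17"
    have "i = i'"
    proof (rule ccontr)
      assume "i \<noteq> i'"
      then have "(h i - h i') mod 17 \<in> {3..14}"
        using far[OF i] by (simp add: far_def)
      moreover obtain k where "h i + j - (h i' + j') = 17 * k"
        using eq by (auto simp: mod_eq_dvd_iff)
      then have "h i - h i' = (j' - j) + 17 * k" by simp
      then have "(h i - h i') mod 17 = (j' - j) mod 17" by simp
      ultimately show False using j by (auto simp: mod17_diff split: if_splits)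
    qed
    moreover have "j = j'"
    proof -
      obtain k where "h i + j - (h i' + j') = 17 * k"
        using eq by (auto simp: mod_eq_dvd_iff)
      then have "j - j' = 17 * k" using \<open>i = i'\<close> by simp
      then show ?thesis using j by presburger
    qed
    ultimately show "i = i' \<and> j = j'" by simp
  qed
  then have "card (?f ` ?P) = 3 * card I"
    by (simp add: card_image card_cartesian_product)
  moreover have "?f ` ?P \<inter> B = {}"
  proof (rule ccontr)
    assume "?f ` ?P \<inter> B \<noteq> {}"
    then obtain i j where i: "i \<in> I" "0 \<le> j" "j < 3" "(h i + j) mod 17 \<in> B" by auto
    from B(2)[OF i(1,4)] i(2,3) show False by (simp add: mod_simps)
  qed
  moreover have "card (?f ` ?P \<union> B) \<le> card {0..<17::int}"
    using B(1) by (intro card_mono) auto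
  moreover have "finite B" using B(1) finite_subset by blast
  ultimately show ?thesis
    using fin by (simp add: card_Un_disjoint)
qed

text \<open>An arc of three residues that covers one of \<open>t + 2\<close>, \<open>t + 3\<close>,
  \<open>t + 4\<close> starts among \<open>t\<close>, ..., \<open>t + 4\<close>. If no arc started
  there, these three residues would stay free, and 15 + 3 > 17.\<close>

lemma window:
  fixes h :: "'a \<Rightarrow> int"
  assumes "card I = 5"
    and far: "\<And>i j. i \<in> I \<Longrightarrow> j \<in> I \<Longrightarrow> i \<noteq> j \<Longrightarrow> far (h i) (h j)"
  shows "\<exists>i\<in>I. (h i - t) mod 17 < 5"
proof (rule ccontr)
  assume no: "\<not> ?thesis"
  let ?B = "{(t + 2) mod 17, (t + 3) mod 17, (t + 4) mod 17}"
  have "(t + 2) mod 17 \<noteq> (t + 3) mod 17 \<and> (t + 2) mod 17 \<noteq> (t + 4) mod 17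
      \<and> (t + 3) mod 17 \<noteq> (t + 4) mod 17" by (simp add: mod_eq_dvd_iff)
  then have B: "card ?B = 3" by simp
  have "3 * card I + card ?B \<le> 17"
  proof (rule packing[OF _ far])
    fix i b assume i: "i \<in> I" and b: "b \<in> ?B"
    obtain w where w: "w = (h i - t) mod 17" by simp
    then have "5 \<le> w" "w < 17" using no i by force+
    moreover have "(t + k - h i) mod 17 = (k - w) mod 17" for k
      unfolding w by (simp add: mod_simps algebra_simps)
    ultimately show "3 \<le> (b - h i) mod 17"
      using b by (auto simp: mod17_diff mod_diff_left_eq)
  qed (use \<open>card I = 5\<close> in \<open>auto intro: card_ge_0_finite\<close>)
  with B \<open>card I = 5\<close> show False by simp
qed

definition proper :: "int list list \<Rightarrow> (int \<Rightarrow> int) \<Rightarrow> bool" where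
  "proper ss g \<longleftrightarrow> (\<forall>s\<in>set ss. \<forall>e\<in>set s. \<forall>f\<in>set s. e \<noteq> f \<longrightarrow> far (g e) (g f))"

lemma proper_uminus: "proper ss g \<Longrightarrow> proper ss (\<lambda>e. - g e)"
  unfolding proper_def using far_uminus by blast

lemma proper_comp:
  assumes "proper ss g" "inj p"
    and "list_all (\<lambda>s. list_ex (\<lambda>s'. list_all (\<lambda>e. List.member s' (p e)) s) ss) ss"
  shows "proper ss (\<lambda>e. g (p e))"
  unfolding proper_def
proof (intro ballI impI)
  fix s e f assume s: "s \<in> set ss" "e \<in> set s" "f \<in> set s" "e \<noteq> f"
  from assms(3) s obtain s' where "s' \<in> set ss" "p e \<in> set s'" "p f \<in> set s'"
    by (fastforce simp: list_all_iff list_ex_iff)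
  with assms(1,2) s(4) show "far (g (p e)) (g (p f))"
    by (auto simp: proper_def dest: injD)
qed

text \<open>
  \<open>X e t\<close> stands for ``edge \<open>e\<close> has colour \<open>t\<close>'' and \<open>A e t\<close> for ``\<open>t\<close> lies in the arc of three
  residues starting at the colour of \<open>e\<close>''. The lists in \<open>ss\<close> collect the edges at a common
  vertex. The clause for five edges at a vertex is redundant, since their arcs leave only two
  residues uncovered, but it makes the search feasible; the pairs \<open>(e, f)\<close> in \<open>ps\<close> break symmetries
  by requiring that \<open>e\<close> comes before \<open>f\<close>.
\<close>

definition residues :: "int list" where
  "residues = [0, 1, 2, 3, 4, 5, 6, 7, 8, 9, 10, 11, 12, 13, 14, 15, 16]"

definition cnf :: "int list list \<Rightarrow> (int \<times> int) list \<Rightarrow> (int \<Rightarrow> int \<Rightarrow> bool) \<Rightarrow> (int \<Rightarrow> int \<Rightarrow> bool) \<Rightarrow> bool" where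
  "cnf ss ps X A \<longleftrightarrow>
    list_all (\<lambda>e. list_ex (X e) residues) (residues @ [17]) \<and>
    list_all (\<lambda>e. list_all (\<lambda>t. X e t \<longrightarrow> A e t \<and> A e ((t + 1) mod 17) \<and> A e ((t + 2) mod 17)) residues) (residues @ [17]) \<and>
    list_all (\<lambda>e. list_all (\<lambda>t. A e t \<longrightarrow> X e t \<or> X e ((t + 16) mod 17) \<or> X e ((t + 15) mod 17)) residues) (residues @ [17]) \<and>
    list_all (\<lambda>e. list_all (\<lambda>t. list_all (\<lambda>u. u < t \<longrightarrow> \<not> X e t \<or> \<not> X e u) residues) residues) (residues @ [17]) \<and>
    list_all (\<lambda>s. list_all (\<lambda>t. list_all (\<lambda>e. list_all (\<lambda>f. e < f \<longrightarrow> \<not> A e t \<or> \<not> A f t) s) s) residues) ss \<and>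
    list_all (\<lambda>s. length s = 5 \<longrightarrow> list_all (\<lambda>t. list_ex (\<lambda>e. X e t \<or> X e ((t + 1) mod 17) \<or> X e ((t + 2) mod 17) \<or> X e ((t + 3) mod 17) \<or> X e ((t + 4) mod 17)) s) residues) ss \<and>
    list_all (\<lambda>(e, f). list_all (\<lambda>t. list_all (\<lambda>u. u < t + 3 \<longrightarrow> \<not> X e t \<or> \<not> X f u) residues) residues) ps"

lemmas cnf_parts =
  cnf_def[THEN iffD1, THEN conjunct1]
  cnf_def[THEN iffD1, THEN conjunct2, THEN conjunct1]
  cnf_def[THEN iffD1, THEN conjunct2, THEN conjunct2, THEN conjunct1]
  cnf_def[THEN iffD1, THEN conjunct2, THEN conjunct2, THEN conjunct2, THEN conjunct1]
  cnf_def[THEN iffD1, THEN conjunct2, THEN conjunct2, THEN conjunct2, THEN conjunct2, THEN conjunct1]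
  cnf_def[THEN iffD1, THEN conjunct2, THEN conjunct2, THEN conjunct2, THEN conjunct2, THEN conjunct2, THEN conjunct1]
  cnf_def[THEN iffD1, THEN conjunct2, THEN conjunct2, THEN conjunct2, THEN conjunct2, THEN conjunct2, THEN conjunct2]

lemma set_residues: "set residues = {0..<17}"
proof -
  have *: "residues = [0..16]" by (simp add: residues_def upto.simps)
  show ?thesis unfolding * by auto
qed

text \<open>Subtracting \<open>g 16\<close> normalises the colour of edge 16 to 0. For a pair in
  \<open>ps\<close>, \<open>far\<close> sharpens \<open>h e < h f\<close> to
  \<open>h e + 3 \<le> h f\<close>, which is the ordering clause.\<close>

lemma cnf_proper:
  fixes g :: "int \<Rightarrow> int"
  defines "h \<equiv> \<lambda>e. (g e - g 16) mod 17"
  assumes "proper ss g" and dist: "list_all distinct ss"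
    and ps: "\<And>e f. (e, f) \<in> set ps \<Longrightarrow> far (g e) (g f) \<and> h e < h f"
  shows "cnf ss ps (\<lambda>e t. h e = t) (\<lambda>e t. (t - h e) mod 17 < 3)"
proof -
  have h: "0 \<le> h e" "h e < 17" for e by (simp_all add: h_def)
  have far_h: "far (h e) (h f) = far (g e) (g f)" for e f
    by (simp add: h_def far_def mod_simps)
  have star: "far (h e) (h f)" if "s \<in> set ss" "e \<in> set s" "f \<in> set s" "e \<noteq> f" for s e f
    using assms(2) that by (auto simp: proper_def far_h)
  show ?thesis
    unfolding cnf_def list_all_iff list_ex_iff set_residues
  proof (intro conjI ballI impI)
    fix e show "\<exists>t\<in>{0..<17}. h e = t" using h by auto
  next
    fix e t show "((t + 1) mod 17 - h e) mod 17 < 3" "((t + 2) mod 17 - h e) mod 17 < 3" "(t - h e) mod 17 < 3"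
      if "h e = t" using that by (auto simp: mod_simps)
  next
    fix e t assume "t \<in> {0..<17::int}" "(t - h e) mod 17 < 3"
    then show "h e = t \<or> h e = (t + 16) mod 17 \<or> h e = (t + 15) mod 17"
      using h[of e] by (auto simp: mod17_diff mod17_add split: if_splits)
  next
    fix e and t u :: int assume "u < t" then show "h e \<noteq> t \<or> h e \<noteq> u" by auto
  next
    fix s e f t assume s: "s \<in> set ss" "e \<in> set s" "f \<in> set s" "e < f" and t: "t \<in> {0..<17::int}"
    then have "far (h e) (h f)" using star by auto
    then show "\<not> (t - h e) mod 17 < 3 \<or> \<not> (t - h f) mod 17 < 3"
      using h[of e] h[of f] t by (auto simp: far_def mod17_diff split: if_splits)
  next
    fix s t assume s: "s \<in> set ss" "length s = 5" and t: "t \<in> {0..<17::int}"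
    have "card (set s) = 5" using dist s by (auto simp: list_all_iff distinct_card)
    then obtain e where e: "e \<in> set s" "(h e - t) mod 17 < 5"
      using window[of "set s" h t] star[OF s(1)] by blast
    then have "h e = t \<or> h e = (t + 1) mod 17 \<or> h e = (t + 2) mod 17 \<or> h e = (t + 3) mod 17
        \<or> h e = (t + 4) mod 17"
      using h[of e] t by (auto simp: mod17_diff mod17_add split: if_splits)
    with e show "\<exists>e\<in>set s. h e = t \<or> h e = (t + 1) mod 17 \<or> h e = (t + 2) mod 17 \<or>
       h e = (t + 3) mod 17 \<or> h e = (t + 4) mod 17" by blast
  next
    fix p assume p: "p \<in> set ps"
    obtain e f where ef: "p = (e, f)" by force
    then have "far (h e) (h f)" "h e < h f" using ps p far_h by auto
    then have "h e + 3 \<le> h f" using h[of e] h[of f] by (auto simp: far_def mod17_diff split: if_splits)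
    then show "case p of (e, f) \<Rightarrow> \<forall>t\<in>{0..<17}. \<forall>u\<in>{0..<17}. u < t + 3 \<longrightarrow> h e \<noteq> t \<or> h f \<noteq> u"
      by (auto simp: ef)
  qed
qed

section \<open>The two blocks\<close>

text \<open>
  Edges are numbered from 0 to 17, and each list contains the edges at one vertex of the block.
  The edges 16 and 17 leave the block: they are \<open>a\<close> and \<open>b\<close>.
\<close>

definition stars1 :: "int list list" where
  "stars1 = [[3, 8, 13, 15], [1, 6, 12, 14, 15], [0, 5, 10, 12, 13], [0, 1, 2, 3, 4],
    [2, 7, 11, 14, 17], [5, 6, 7, 8, 9], [4, 9, 10, 11, 16]]"

definition stars2 :: "int list list" where
  "stars2 = [[6, 7, 10, 13, 16], [0, 1, 10, 11, 12], [0, 2, 4, 6, 8], [2, 3, 12, 13, 15],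
    [1, 3, 5, 7, 9], [8, 9, 11, 14, 15], [4, 5, 14, 17]]"

text \<open>Fixing both boundary colours gives one propositional instance per residue. Residues are
  treated only up to sign, since negating a colouring handles the opposite ones.\<close>

lemma block1_avoids_1:
  assumes "cnf stars1 [(4, 9)] X A" "X 16 0"
  shows "\<not> X 17 1"
proof
  assume "X 17 1"
  note cnf = cnf_parts[OF assms(1), unfolded residues_def stars1_def]
  from assms(2) \<open>X 17 1\<close> cnf[simplified] show False by sat
qed

lemma block1_avoids_3:
  assumes "cnf stars1 [(4, 9)] X A" "X 16 0"
  shows "\<not> X 17 3"
proof
  assume "X 17 3"
  note cnf = cnf_parts[OF assms(1), unfolded residues_def stars1_def]
  from assms(2) \<open>X 17 3\<close> cnf[simplified] show False by sat
qed

lemma block1_avoids_5: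
  assumes "cnf stars1 [(4, 9)] X A" "X 16 0"
  shows "\<not> X 17 5"
proof
  assume "X 17 5"
  note cnf = cnf_parts[OF assms(1), unfolded residues_def stars1_def]
  from assms(2) \<open>X 17 5\<close> cnf[simplified] show False by sat
qed

lemma block1_avoids_8:
  assumes "cnf stars1 [(4, 9)] X A" "X 16 0"
  shows "\<not> X 17 8"
proof
  assume "X 17 8"
  note cnf = cnf_parts[OF assms(1), unfolded residues_def stars1_def]
  from assms(2) \<open>X 17 8\<close> cnf[simplified] show False by sat
qed

lemma block2_avoids_0:
  assumes "cnf stars2 [(6, 7), (10, 13)] X A" "X 16 0"
  shows "\<not> X 17 0"
proof
  assume "X 17 0"
  note cnf = cnf_parts[OF assms(1), unfolded residues_def stars2_def]
  from assms(2) \<open>X 17 0\<close> cnf[simplified] show False by sat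
qed

lemma block2_avoids_6:
  assumes "cnf stars2 [(6, 7), (10, 13)] X A" "X 16 0"
  shows "\<not> X 17 6"
proof
  assume "X 17 6"
  note cnf = cnf_parts[OF assms(1), unfolded residues_def stars2_def]
  from assms(2) \<open>X 17 6\<close> cnf[simplified] show False by sat
qed

text \<open>The automorphisms of the blocks that justify the symmetry-breaking pairs.\<close>

definition swap1 :: "int \<Rightarrow> int" where
  "swap1 e = (if e \<in> {0..4} then e + 5 else if e \<in> {5..9} then e - 5 else e)"

definition swap2 :: "int \<Rightarrow> int" where
  "swap2 e = (if e \<in> {0..9} then (if even e then e + 1 else e - 1) else e)"

definition swap3 :: "int \<Rightarrow> int" where
  "swap3 e = (if e \<in> {0, 1} then e + 2 else if e \<in> {2, 3} then e - 2 else if e = 10 then 13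
     else if e = 13 then 10 else if e = 11 then 15 else if e = 15 then 11 else e)"

text \<open>\<open>swap1\<close> comes from exchanging the vertices 3 and 5 of
  \<open>block1\<close>, which have the same neighbours.\<close>

lemma proper_swap1:
  assumes "proper stars1 g" shows "proper stars1 (\<lambda>e. g (swap1 e))"
proof (rule proper_comp[OF assms])
  show "inj swap1" by (rule inj_on_inverseI[of _ swap1]) (auto simp: swap1_def)
qed (simp add: stars1_def swap1_def)

text \<open>\<open>swap2\<close> comes from exchanging the vertices 9 and 11 of
  \<open>block2\<close>, which have the same neighbours.\<close>

lemma proper_swap2:
  assumes "proper stars2 g" shows "proper stars2 (\<lambda>e. g (swap2 e))"
proof (rule proper_comp[OF assms])
  show "inj swap2" by (rule inj_on_inverseI[of _ swap2]) (auto simp: swap2_def, presburger+)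
qed (simp add: stars2_def swap2_def)

text \<open>\<open>swap3\<close> comes from exchanging the vertices 8 and 10 of
  \<open>block2\<close>, which are adjacent and otherwise have the same neighbours.\<close>

lemma proper_swap3:
  assumes "proper stars2 g" shows "proper stars2 (\<lambda>e. g (swap3 e))"
proof (rule proper_comp[OF assms])
  show "inj swap3" by (rule inj_on_inverseI[of _ swap3]) (auto simp: swap3_def)
qed (simp add: stars2_def swap3_def)

lemma properD:
  assumes "proper ss g" "list_ex (\<lambda>s. List.member s e \<and> List.member s f) ss" "e \<noteq> f"
  shows "far (g e) (g f)"
  using assms by (auto simp: proper_def list_ex_iff)

lemma far_mod_less:
  assumes "far x y" shows "(x - z) mod 17 < (y - z) mod 17 \<or> (y - z) mod 17 < (x - z) mod 17"
proof (rule ccontr)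
  assume "\<not> ?thesis"
  then have "(x - z) mod 17 = (y - z) mod 17" by simp
  then have "(x - y) mod 17 = 0" by (metis mod_diff_cong diff_diff_eq2 diff_add_cancel diff_self mod_0 mod_diff_eq add_diff_cancel_right')
  with assms show False by (simp add: far_def)
qed

lemma forbidden1:
  assumes g: "proper stars1 g"
  shows "(g 17 - g 16) mod 17 \<notin> {1, 3, 5, 8}"
proof -
  have main: "(g 17 - g 16) mod 17 \<notin> {1, 3, 5, 8}"
    if g: "proper stars1 g" and less: "(g 4 - g 16) mod 17 < (g 9 - g 16) mod 17" for g
  proof -
    have "far (g 4) (g 9)" by (rule properD[OF g]) (simp_all add: stars1_def)
    then have "cnf stars1 [(4, 9)] (\<lambda>e t. (g e - g 16) mod 17 = t) (\<lambda>e t. (t - (g e - g 16) mod 17) mod 17 < 3)"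
      using less by (intro cnf_proper g) (auto simp: stars1_def)
    from block1_avoids_1[OF this] block1_avoids_3[OF this] block1_avoids_5[OF this] block1_avoids_8[OF this]
    show ?thesis by auto
  qed
  have "far (g 4) (g 9)" by (rule properD[OF g]) (simp_all add: stars1_def)
  then consider "(g 4 - g 16) mod 17 < (g 9 - g 16) mod 17" | "(g 9 - g 16) mod 17 < (g 4 - g 16) mod 17"
    using far_mod_less by blast
  then show ?thesis
  proof cases
    case 2
    then show ?thesis using main[OF proper_swap1[OF g]] by (simp add: swap1_def)
  qed (rule main[OF g])
qed

lemma forbidden2:
  assumes g: "proper stars2 g"
  shows "(g 17 - g 16) mod 17 \<notin> {0, 6}"
proof -
  have far: "far (g 6) (g 7)" "far (g 10) (g 13)" if "proper stars2 g" for g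
    by (rule properD[OF that], simp_all add: stars2_def)+
  have main: "(g 17 - g 16) mod 17 \<notin> {0, 6}"
    if g: "proper stars2 g" and less: "(g 6 - g 16) mod 17 < (g 7 - g 16) mod 17"
      "(g 10 - g 16) mod 17 < (g 13 - g 16) mod 17" for g
  proof -
    have "cnf stars2 [(6, 7), (10, 13)] (\<lambda>e t. (g e - g 16) mod 17 = t) (\<lambda>e t. (t - (g e - g 16) mod 17) mod 17 < 3)"
      using less far[OF g] by (intro cnf_proper g) (auto simp: stars2_def)
    from block2_avoids_0[OF this] block2_avoids_6[OF this] show ?thesis by auto
  qed
  \<comment> \<open>\<open>swap3\<close> fixes the edges 6 and 7, so it can put 10 before 13 without
    disturbing the order of 6 and 7.\<close>
  have main': "(g 17 - g 16) mod 17 \<notin> {0, 6}"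
    if g: "proper stars2 g" and less: "(g 6 - g 16) mod 17 < (g 7 - g 16) mod 17" for g
    using far_mod_less[OF far(2)[OF g], of "g 16"] less main[OF g] main[OF proper_swap3[OF g]]
    by (auto simp: swap3_def)
  show ?thesis
    using far_mod_less[OF far(1)[OF g], of "g 16"] main'[OF g] main'[OF proper_swap2[OF g]]
    by (auto simp: swap2_def)
qed

section \<open>The graphs and the lower bound\<close>

text \<open>
  The third components are a colouring of the graph in units of \<open>1/3\<close>. The positions in the lists
  match the edge numbers above, so that both lists end with \<open>a\<close> and \<open>b\<close>. The vertices are numbered
  along a Hamiltonian cycle.
\<close>

definition block1 :: "(nat \<times> nat \<times> int) list" where
  "block1 = [(2, 3, 13), (1, 3, 2), (3, 4, 10), (0, 3, 16), (3, 6, 6), (2, 5, 5), (1, 5, 8), (4, 5, 0), (0,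
    5, 11), (5, 6, 14), (2, 6, 10), (4, 6, 3), (1, 2, 16), (0, 2, 2), (1, 4, 13), (0, 1, 5), (6, 7,
    0), (4, 13, 7)]"

definition block2 :: "(nat \<times> nat \<times> int) list" where
  "block2 = [(8, 9, 0), (8, 11, 9), (9, 10, 3), (10, 11, 12), (9, 13, 11), (11, 13, 15), (7, 9, 14), (7,
    11, 6), (9, 12, 7), (11, 12, 1), (7, 8, 3), (8, 12, 12), (8, 10, 6), (7, 10, 9), (12, 13, 4),
    (10, 12, 15), (6, 7, 0), (4, 13, 7)]"

definition block_edge :: "(nat \<times> nat \<times> int) list \<Rightarrow> int \<Rightarrow> nat set" where
  "block_edge b i = (case b ! nat i of (u, v, _) \<Rightarrow> {u, v})"

definition blocks :: "(nat \<times> nat \<times> int) list" where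
  "blocks = block1 @ block2"

definition next_vertex :: "nat \<Rightarrow> nat \<Rightarrow> nat" where
  "next_vertex n i = (if i = 2 * n + 14 then 0 else Suc i)"

definition G :: "nat \<Rightarrow> nat graph" where
  "G n = \<lparr>verts = {..<2 * n + 15},
     edges = (\<lambda>(u, v, _). {u, v}) ` set blocks \<union> (\<lambda>i. {i, next_vertex n i}) ` {13..<2 * n + 15}\<rparr>"

section \<open>Circular edge-colourings: enlarging \<open>r\<close>, rotation and rounding\<close>

lemma circular_edge_colouringD:
  assumes "circular_edge_colouring H r c" "e \<in> edges H" "f \<in> edges H" "e \<noteq> f" "e \<inter> f \<noteq> {}"
  shows "1 \<le> \<bar>c e - c f\<bar>" "\<bar>c e - c f\<bar> \<le> r - 1"
  using assms unfolding circular_edge_colouring_def by blast+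

lemma circular_edge_colouring_range:
  assumes "circular_edge_colouring H r c" "e \<in> edges H"
  shows "0 \<le> c e" "c e < r"
  using assms by (auto simp: circular_edge_colouring_def)

lemma circular_edge_colouring_mono:
  assumes c: "circular_edge_colouring H r c" and r: "r \<le> r'"
  shows "circular_edge_colouring H r' c"
  unfolding circular_edge_colouring_def
proof (intro conjI ballI impI; (elim conjE)?)
  fix e assume "e \<in> edges H"
  from circular_edge_colouring_range[OF c this] r show "c e \<in> {0..<r'}" by simp
next
  fix e f assume "e \<in> edges H" "f \<in> edges H" "e \<noteq> f" "e \<inter> f \<noteq> {}"
  from circular_edge_colouringD[OF c this] r
  show "1 \<le> \<bar>c e - c f\<bar>" "\<bar>c e - c f\<bar> \<le> r' - 1" by simp_all
qed

text \<open>If exactly one of two colours wraps around, their distance d becomes r - d, and the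
  condition on d is symmetric under this exchange.\<close>

lemma circular_edge_colouring_rotate:
  assumes c: "circular_edge_colouring H r c" and s: "0 \<le> s" "s < r"
  shows "circular_edge_colouring H r (\<lambda>e. if s \<le> c e then c e - s else c e - s + r)"
  unfolding circular_edge_colouring_def
proof (intro conjI ballI impI; (elim conjE)?)
  fix e assume "e \<in> edges H"
  from circular_edge_colouring_range[OF c this] s
  show "(if s \<le> c e then c e - s else c e - s + r) \<in> {0..<r}" by auto
next
  fix e f assume ef: "e \<in> edges H" "f \<in> edges H" "e \<noteq> f" "e \<inter> f \<noteq> {}"
  note d = circular_edge_colouringD[OF c ef] circular_edge_colouring_range[OF c ef(1)]
    circular_edge_colouring_range[OF c ef(2)]
  show "1 \<le> \<bar>(if s \<le> c e then c e - s else c e - s + r) - (if s \<le> c f then c f - s else c f - s + r)\<bar>"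
    using d s by (simp add: abs_real_def split: if_splits)
  show "\<bar>(if s \<le> c e then c e - s else c e - s + r) - (if s \<le> c f then c f - s else c f - s + r)\<bar> \<le> r - 1"
    using d s by (simp add: abs_real_def split: if_splits)
qed

text \<open>Shifting by the integers 3 and 14 commutes with the floor, so its monotonicity keeps
  both bounds. The free offset \<open>s\<close> later allows a colour difference to be rounded down
  as well as up.\<close>

lemma far_floor:
  fixes x y s :: real
  assumes "1 \<le> \<bar>x - y\<bar>" "\<bar>x - y\<bar> \<le> 14 / 3"
  shows "far \<lfloor>3 * x + s\<rfloor> \<lfloor>3 * y + s\<rfloor>"
proof -
  have *: "far \<lfloor>3 * x + s\<rfloor> \<lfloor>3 * y + s\<rfloor>" if "1 \<le> x - y" "x - y \<le> 14 / 3" for x y :: real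
  proof -
    have "\<lfloor>3 * y + s + 3\<rfloor> \<le> \<lfloor>3 * x + s\<rfloor>" "\<lfloor>3 * x + s\<rfloor> \<le> \<lfloor>3 * y + s + 14\<rfloor>"
      using that by (intro floor_mono; simp)+
    then show ?thesis by (simp add: far_def)
  qed
  show ?thesis
  proof (cases "y \<le> x")
    case True
    then show ?thesis using assms by (intro *) auto
  next
    case False
    then show ?thesis using assms by (intro far_sym[OF *]) auto
  qed
qed

text \<open>\<open>vs\<close> names a common end-vertex for the edges of each list, so the colouring
  condition with \<open>r - 1 \<le> 14 / 3\<close> holds within a list and \<open>far_floor\<close>
  applies.\<close>

lemma proper_block:
  assumes c: "circular_edge_colouring H r c" "r \<le> 17 / 3"
    and b: "block_edge b ` set (concat ss) \<subseteq> edges H" "inj_on (block_edge b) (set (concat ss))"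
    and ss: "list_all2 (\<lambda>v s. list_all (\<lambda>e. v \<in> block_edge b e) s) vs ss"
  shows "proper ss (\<lambda>e. \<lfloor>3 * c (block_edge b e) + t\<rfloor>)"
  unfolding proper_def
proof (intro ballI impI)
  fix s e f assume s: "s \<in> set ss" "e \<in> set s" "f \<in> set s" "e \<noteq> f"
  obtain i where "i < length ss" "s = ss ! i" using s(1) by (auto simp: in_set_conv_nth)
  then have "list_all (\<lambda>e. vs ! i \<in> block_edge b e) s"
    using ss by (simp add: list_all2_conv_all_nth)
  then have "block_edge b e \<inter> block_edge b f \<noteq> {}" using s by (auto simp: list_all_iff)
  moreover have "block_edge b e \<in> edges H" "block_edge b f \<in> edges H" using s b(1) by auto
  moreover have "block_edge b e \<noteq> block_edge b f" using b(2) s by (auto dest: inj_onD)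
  ultimately show "far \<lfloor>3 * c (block_edge b e) + t\<rfloor> \<lfloor>3 * c (block_edge b f) + t\<rfloor>"
    using circular_edge_colouringD[OF c(1), of "block_edge b e" "block_edge b f"] c(2)
    by (intro far_floor) simp_all
qed

lemma block1_edge:
  "block_edge block1 16 = {6, 7}" "block_edge block1 17 = {4, 13}"
  "block_edge block2 16 = {6, 7}" "block_edge block2 17 = {4, 13}"
  by (simp_all add: block_edge_def block1_def block2_def)

lemma proper_block1:
  assumes "circular_edge_colouring (G n) r c" "r \<le> 17 / 3"
  shows "proper stars1 (\<lambda>e. \<lfloor>3 * c (block_edge block1 e) + t\<rfloor>)"
proof (rule proper_block[OF assms])
  show "block_edge block1 ` set (concat stars1) \<subseteq> edges (G n)"
    by (auto simp: block_edge_def G_def blocks_def stars1_def block1_def)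
  show "inj_on (block_edge block1) (set (concat stars1))"
    by (simp add: inj_on_def block_edge_def stars1_def block1_def doubleton_eq_iff)
  show "list_all2 (\<lambda>v s. list_all (\<lambda>e. v \<in> block_edge block1 e) s) [0, 1, 2, 3, 4, 5, 6] stars1"
    by (simp add: stars1_def block_edge_def block1_def)
qed

lemma proper_block2:
  assumes "circular_edge_colouring (G n) r c" "r \<le> 17 / 3"
  shows "proper stars2 (\<lambda>e. \<lfloor>3 * c (block_edge block2 e) + t\<rfloor>)"
proof (rule proper_block[OF assms])
  show "block_edge block2 ` set (concat stars2) \<subseteq> edges (G n)"
    by (auto simp: block_edge_def G_def blocks_def stars2_def block2_def)
  show "inj_on (block_edge block2) (set (concat stars2))"
    by (simp add: inj_on_def block_edge_def stars2_def block2_def doubleton_eq_iff)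
  show "list_all2 (\<lambda>v s. list_all (\<lambda>e. v \<in> block_edge block2 e) s) [7, 8, 9, 10, 11, 12, 13] stars2"
    by (simp add: stars2_def block_edge_def block2_def)
qed

text \<open>The negated residue colouring is proper too, so every exclusion also removes the
  opposite residue.\<close>

lemma floor_difference_allowed:
  assumes c: "circular_edge_colouring (G n) r c" "r \<le> 17 / 3"
  shows "(\<lfloor>3 * c {4, 13} + t\<rfloor> - \<lfloor>3 * c {6, 7} + t\<rfloor>) mod 17 \<in> {2, 4, 7, 10, 13, 15}" (is "?d mod 17 \<in> _")
proof -
  have "?d mod 17 \<notin> {1, 3, 5, 8}" "- ?d mod 17 \<notin> {1, 3, 5, 8}" "?d mod 17 \<notin> {0, 6}" "- ?d mod 17 \<notin> {0, 6}"
    using forbidden1[OF proper_block1[OF c]] forbidden1[OF proper_uminus[OF proper_block1[OF c]]]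
      forbidden2[OF proper_block2[OF c]] forbidden2[OF proper_uminus[OF proper_block2[OF c]]]
    by (simp_all add: block1_edge)
  moreover have "- ?d mod 17 = (if ?d mod 17 = 0 then 0 else 17 - ?d mod 17)"
    by (rule zmod_zminus1_eq_if)
  moreover have "?d mod 17 \<in> set residues" by (simp add: set_residues)
  ultimately show ?thesis unfolding residues_def by (auto split: if_splits)
qed

section \<open>The lower bound 17/3\<close>

lemma circular_colouring_lower_bound:
  assumes c: "circular_edge_colouring (G n) r c"
  shows "17 / 3 \<le> r"
proof (rule ccontr)
  assume "\<not> 17 / 3 \<le> r"
  \<comment> \<open>Raising \<open>r\<close> to at least 11/2 ensures that \<open>3 * R\<close> lies
    between 16 and 17, so that its floor is 16.\<close>
  define R where "R = max r (11 / 2)"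
  have R: "11 / 2 \<le> R" "R < 17 / 3" using \<open>\<not> 17 / 3 \<le> r\<close> by (auto simp: R_def)
  let ?D = "{2, 4, 7, 10, 13, 15} :: int set"
  let ?a = "{6, 7} :: nat set" and ?b = "{4, 13} :: nat set"
  have edges: "?a \<in> edges (G n)" "?b \<in> edges (G n)" by (auto simp: G_def blocks_def block1_def)
  have c: "circular_edge_colouring (G n) R c"
    by (rule circular_edge_colouring_mono[OF c]) (simp add: R_def)
  define rot where "rot s = (\<lambda>e. if s \<le> c e then c e - s else c e - s + R)" for s
  have rot: "circular_edge_colouring (G n) R (rot (c e))" if "e \<in> edges (G n)" for e
    unfolding rot_def using circular_edge_colouring_range[OF c that] by (intro circular_edge_colouring_rotate c)
  define y where "y = rot (c ?a) ?b"
  have y: "0 \<le> y" "y < R" using circular_edge_colouring_range[OF rot edges(2)] edges(1) by (auto simp: y_def)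
  have "\<lfloor>3 * y\<rfloor> mod 17 \<in> ?D"
    using floor_difference_allowed[OF rot[OF edges(1)], of 0] R by (simp add: y_def rot_def)
  moreover have "0 \<le> \<lfloor>3 * y\<rfloor>" "\<lfloor>3 * y\<rfloor> < 17" using y R by linarith+
  ultimately have floor: "\<lfloor>3 * y\<rfloor> \<in> ?D" by (metis mod_pos_pos_trivial)
  \<comment> \<open>With offset \<open>- 3 * y\<close> the colour of \<open>?b\<close> rounds to 0
    and that of \<open>?a\<close> to the floor of \<open>- 3 * y\<close>; their difference is the
    ceiling of \<open>3 * y\<close>.\<close>
  have "(- \<lfloor>- 3 * y\<rfloor>) mod 17 \<in> ?D"
    using floor_difference_allowed[OF rot[OF edges(1)], of "- 3 * y"] R by (simp add: y_def rot_def)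
  then have "\<lceil>3 * y\<rceil> mod 17 \<in> ?D" by (simp add: ceiling_def)
  then have "\<lceil>3 * y\<rceil> \<in> ?D \<or> \<lceil>3 * y\<rceil> = 17" 
  proof (cases "\<lceil>3 * y\<rceil> = 17")
    case False
    then have "0 \<le> \<lceil>3 * y\<rceil>" "\<lceil>3 * y\<rceil> < 17" using y R by linarith+
    then show ?thesis using \<open>\<lceil>3 * y\<rceil> mod 17 \<in> ?D\<close> by simp
  qed simp
  moreover have "\<lceil>3 * y\<rceil> = \<lfloor>3 * y\<rfloor> \<or> \<lceil>3 * y\<rceil> = \<lfloor>3 * y\<rfloor> + 1" by linarith
  \<comment> \<open>No two elements of \<open>?D\<close> are consecutive, and the extra value 17
    drops out because neither 16 nor 17 is in \<open>?D\<close>.\<close>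
  moreover have "q = p" if "p \<in> ?D" "q \<in> ?D \<or> q = 17" "q = p \<or> q = p + 1" for p q
    using that by auto
  ultimately have "\<lceil>3 * y\<rceil> = \<lfloor>3 * y\<rfloor>" using floor by blast
  then obtain m where m: "3 * y = real_of_int m" "m \<in> ?D" using floor by (metis ceiling_correct floor_correct order.antisym)
  then have "y > 0" by auto
  \<comment> \<open>For \<open>y = 0\<close> both edges would have the same colour and the rotated
    value would be 0 instead of \<open>R\<close>.\<close>
  then have "rot (c ?b) ?a = R - y" "rot (c ?b) ?b = 0" unfolding y_def rot_def by (auto split: if_splits)
  then have "(- \<lfloor>3 * (R - y)\<rfloor>) mod 17 \<in> ?D"
    using floor_difference_allowed[OF rot[OF edges(2)], of 0] R by simp
  \<comment> \<open>The difference from \<open>?a\<close> to \<open>?b\<close> is now m - 16,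
    congruent to m + 1, which is not in \<open>?D\<close> when m is.\<close>
  moreover have "\<lfloor>3 * (R - y)\<rfloor> = 16 - m" using R m(1) by (intro floor_unique) simp_all
  ultimately show False using m(2) by auto
qed

section \<open>Colouring, degrees and connectivity\<close>

text \<open>The path from 13 through the vertices from 14 on to 0 has \<open>2 * n + 2\<close>
  edges. As this number is even, alternating colours end with 1 at vertex 13 and 8 at vertex 0,
  which fit the block colours there.\<close>

definition coloured_edges :: "nat \<Rightarrow> (nat set \<times> int) set" where
  "coloured_edges n = (\<lambda>(u, v, k). ({u, v}, k)) ` set blocks \<union>
     (\<lambda>i. ({i, next_vertex n i}, if even i then 8 else 1)) ` {13..<2 * n + 15}"

lemma edges_G: "edges (G n) = fst ` coloured_edges n"
  unfolding G_def coloured_edges_def by (force simp: image_Un image_image case_prod_beta)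

lemma block_bounds:
  assumes "(u, v, k) \<in> set blocks"
  shows "u < v" "v < 14" "0 \<le> k" "k < 17"
proof -
  have "list_all (\<lambda>(u, v, k). u < v \<and> v < 14 \<and> 0 \<le> k \<and> k < 17) blocks"
    by (simp add: blocks_def block1_def block2_def)
  with assms show "u < v" "v < 14" "0 \<le> k" "k < 17" by (auto simp: list_all_iff)
qed

lemma block_colours:
  assumes "(u, v, k) \<in> set blocks" "(u', v', k') \<in> set blocks" "u = u' \<or> u = v' \<or> v = u' \<or> v = v'"
  shows "u = u' \<and> v = v' \<and> k = k' \<or> 3 \<le> \<bar>k - k'\<bar> \<and> \<bar>k - k'\<bar> \<le> 14"
proof -
  have "list_all (\<lambda>(u, v, k). list_all (\<lambda>(u', v', k'). u = u' \<or> u = v' \<or> v = u' \<or> v = v' \<longrightarrow>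
    u = u' \<and> v = v' \<and> k = k' \<or> 3 \<le> \<bar>k - k'\<bar> \<and> \<bar>k - k'\<bar> \<le> 14) blocks) blocks"
    by (simp add: blocks_def block1_def block2_def)
  with assms show ?thesis unfolding list_all_iff by fast
qed

lemma block_colours_ear:
  assumes "(u, v, k) \<in> set blocks"
  shows "(u = 0 \<or> v = 0 \<longrightarrow> 3 \<le> \<bar>k - 8\<bar> \<and> \<bar>k - 8\<bar> \<le> 14) \<and> (u = 13 \<or> v = 13 \<longrightarrow> 3 \<le> \<bar>k - 1\<bar> \<and> \<bar>k - 1\<bar> \<le> 14)"
proof -
  have "list_all (\<lambda>(u, v, k). (u = 0 \<or> v = 0 \<longrightarrow> 3 \<le> \<bar>k - 8\<bar> \<and> \<bar>k - 8\<bar> \<le> 14) \<and> (u = 13 \<or> v = 13 \<longrightarrow> 3 \<le> \<bar>k - 1\<bar> \<and> \<bar>k - 1\<bar> \<le> 14)) blocks"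
    by (simp add: blocks_def block1_def block2_def)
  with assms show ?thesis unfolding list_all_iff by fast
qed

lemma coloured_edges_proper:
  assumes "(e, k) \<in> coloured_edges n" "(f, l) \<in> coloured_edges n" "e \<inter> f \<noteq> {}"
  shows "e = f \<and> k = l \<or> 3 \<le> \<bar>k - l\<bar> \<and> \<bar>k - l\<bar> \<le> 14"
proof -
  let ?ear = "\<lambda>e k i. i \<in> {13..<2 * n + 15} \<and> e = {i, next_vertex n i} \<and> k = (if even i then 8 else 1 :: int)"
  let ?block = "\<lambda>e k u v. (u, v, k) \<in> set blocks \<and> e = {u, v}"
  have mixed: "3 \<le> \<bar>k - l\<bar> \<and> \<bar>k - l\<bar> \<le> 14" if b: "?block e k u v" and i: "?ear f l i" and "e \<inter> f \<noteq> {}" for e f k l u v i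
  proof -
    have "u < 14" "v < 14" using block_bounds[of u v k] b by auto
    moreover have "u \<in> f \<or> v \<in> f" using b \<open>e \<inter> f \<noteq> {}\<close> by auto
    \<comment> \<open>Block edges have both ends below 14, so they meet the path only in its
      end-vertices 13 and 0.\<close>
    ultimately have "i = 13 \<and> (u = 13 \<or> v = 13) \<or> i = 2 * n + 14 \<and> (u = 0 \<or> v = 0)"
      using i by (auto simp: next_vertex_def split: if_splits)
    then show ?thesis using block_colours_ear[of u v k] b i by auto
  qed
  have cases: "(\<exists>u v. ?block e k u v) \<or> (\<exists>i. ?ear e k i)" if "(e, k) \<in> coloured_edges n" for e k
    using that by (auto simp: coloured_edges_def)
  from cases[OF assms(1)] cases[OF assms(2)] show ?thesis
  proof (elim disjE exE)
    fix u v u' v' assume b: "?block e k u v" "?block f l u' v'"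
    then have "u = u' \<or> u = v' \<or> v = u' \<or> v = v'" using assms(3) by auto
    then show ?thesis using block_colours[of u v k u' v' l] b by auto
  next
    fix u v i assume "?block e k u v" "?ear f l i"
    from mixed[OF this assms(3)] show ?thesis ..
  next
    fix u v i assume "?ear e k i" "?block f l u v"
    from mixed[OF this(2,1)] assms(3) have "3 \<le> \<bar>l - k\<bar> \<and> \<bar>l - k\<bar> \<le> 14" by blast
    then show ?thesis by (simp add: abs_minus_commute)
  next
    fix i j assume ij: "?ear e k i" "?ear f l j"
    \<comment> \<open>Distinct path edges that meet have consecutive indices, hence different parity
      and the colours 1 and 8.\<close>
    then have "i = j \<or> i = Suc j \<or> j = Suc i"
      using assms(3) by (auto simp: next_vertex_def split: if_splits)
    then show ?thesis using ij by auto
  qed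
qed

lemma circular_colouring_G: "\<exists>c. circular_edge_colouring (G n) (17 / 3) c"
proof -
  \<comment> \<open>Any recorded colour will do, because \<open>coloured_edges_proper\<close>
    compares arbitrary records of distinct edges.\<close>
  define k where "k e = (SOME k. (e, k) \<in> coloured_edges n)" for e
  have k: "(e, k e) \<in> coloured_edges n" if "e \<in> edges (G n)" for e
    using that unfolding k_def edges_G by (auto intro: someI)
  have "circular_edge_colouring (G n) (17 / 3) (\<lambda>e. real_of_int (k e) / 3)"
    unfolding circular_edge_colouring_def
  proof (intro conjI ballI impI; (elim conjE)?)
    fix e assume "e \<in> edges (G n)"
    from k[OF this] have "0 \<le> k e \<and> k e < 17"
      using block_bounds(3,4) by (auto simp: coloured_edges_def split: if_splits)
    then show "real_of_int (k e) / 3 \<in> {0..<17 / 3}" by simp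
  next
    fix e f assume "e \<in> edges (G n)" "f \<in> edges (G n)" "e \<noteq> f" "e \<inter> f \<noteq> {}"
    then have "3 \<le> \<bar>k e - k f\<bar> \<and> \<bar>k e - k f\<bar> \<le> 14"
      using coloured_edges_proper[OF k k] by blast
    then have "3 \<le> \<bar>real_of_int (k e) - real_of_int (k f)\<bar>" "\<bar>real_of_int (k e) - real_of_int (k f)\<bar> \<le> 14"
      by linarith+
    then show "1 \<le> \<bar>real_of_int (k e) / 3 - real_of_int (k f) / 3\<bar>"
      "\<bar>real_of_int (k e) / 3 - real_of_int (k f) / 3\<bar> \<le> 17 / 3 - 1"
      by (simp_all add: diff_divide_distrib[symmetric] abs_divide)
  qed
  then show ?thesis by blast
qed

lemma circular_chromatic_index_G: "circular_chromatic_index (G n) = 17 / 3"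
  unfolding circular_chromatic_index_def
  using circular_colouring_G circular_colouring_lower_bound by (intro cInf_eq_minimum) auto

section \<open>Simplicity and maximum degree\<close>

lemma simple_graph_G: "simple_graph (G n)"
  unfolding simple_graph_def
proof (intro conjI ballI)
  show "finite (verts (G n))" by (simp add: G_def)
  fix e assume "e \<in> edges (G n)"
  then consider u v k where "(u, v, k) \<in> set blocks" "e = {u, v}"
    | i where "i \<in> {13..<2 * n + 15}" "e = {i, next_vertex n i}"
    unfolding G_def by auto
  then have "e \<subseteq> verts (G n) \<and> card e = 2"
  proof cases
    case 1
    then have "u < v" "v < 14" using block_bounds by auto
    then show ?thesis using 1(2) by (auto simp: G_def)
  next
    case 2
    then show ?thesis by (auto simp: G_def next_vertex_def)
  qed
  then show "e \<subseteq> verts (G n)" "card e = 2" by auto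
qed

text \<open>Each edge at \<open>v\<close> occupies an arc of three of the 17 residues, and six such
  arcs do not fit.\<close>

lemma degree_le:
  assumes c: "circular_edge_colouring H (17 / 3) c" and fin: "finite (edges H)"
  shows "degree H v \<le> 5"
proof -
  let ?E = "{e \<in> edges H. v \<in> e}"
  have "far \<lfloor>3 * c e + 0\<rfloor> \<lfloor>3 * c f + 0\<rfloor>" if "e \<in> ?E" "f \<in> ?E" "e \<noteq> f" for e f
    using that circular_edge_colouringD[OF c, of e f] by (intro far_floor) auto
  then have "3 * card ?E + card ({} :: int set) \<le> 17"
    using fin by (intro packing[of _ "\<lambda>e. \<lfloor>3 * c e + 0\<rfloor>"]) auto
  then show ?thesis by (simp add: degree_def)
qed

lemma max_degree_G: "max_degree (G n) = 5"
  unfolding max_degree_def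
proof (rule Max_eqI)
  have fin: "finite (edges (G n))" by (simp add: G_def)
  obtain c where c: "circular_edge_colouring (G n) (17 / 3) c" using circular_colouring_G by blast
  show "finite (degree (G n) ` verts (G n))" by (simp add: G_def)
  show "d \<le> 5" if "d \<in> degree (G n) ` verts (G n)" for d
    using that degree_le[OF c fin] by auto
  have "{{2, 3}, {1, 3}, {3, 4}, {0, 3}, {3, 6}} \<subseteq> {e \<in> edges (G n). 3 \<in> e}"
    by (simp add: G_def blocks_def block1_def)
  from card_mono[OF _ this] fin have "card {{2, 3}, {1, 3}, {3, 4}, {0, 3}, {3, 6 :: nat}} \<le> degree (G n) 3"
    by (simp add: degree_def)
  moreover have "card {{2, 3}, {1, 3}, {3, 4}, {0, 3}, {3, 6 :: nat}} = 5"
    by (simp add: doubleton_eq_iff)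
  ultimately have "degree (G n) 3 = 5" using degree_le[OF c fin, of 3] by simp
  moreover have "3 \<in> verts (G n)" by (simp add: G_def)
  ultimately show "5 \<in> degree (G n) ` verts (G n)" by force
qed

section \<open>2-connectedness from a Hamiltonian cycle\<close>

lemma hamiltonian_2_connected:
  assumes N: "verts H = {..<N}" "3 \<le> N"
    and cycle: "\<And>i. i < N \<Longrightarrow> {i, Suc i mod N} \<in> edges H"
  shows "k_connected 2 H"
  unfolding k_connected_def
proof (intro conjI allI impI)
  show "2 < card (verts H)" using N by simp
  fix X assume X: "X \<subseteq> verts H" "card X < 2"
  let ?R = "{(x, y). {x, y} \<in> edges (delete_verts H X)}"
  obtain v where v: "v < N" "X \<subseteq> {v}"
  proof (cases "X = {}")
    case True
    then show ?thesis using that[of 0] N by simp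
  next
    case False
    moreover have "finite X" using X(1) N(1) finite_subset by fastforce
    ultimately have "0 < card X" by (simp add: card_gt_0_iff)
    then have "card X = 1" using X(2) by linarith
    then obtain v where "X = {v}" by (auto simp: card_1_singleton_iff)
    then show ?thesis using that[of v] X(1) N(1) by auto
  qed
  \<comment> \<open>\<open>w\<close> runs once around the cycle, starting just after
    \<open>v\<close>. The vertex \<open>v\<close> therefore comes last, at position
    \<open>N - 1\<close>, and deleting it leaves the earlier walk intact. If \<open>X\<close> is
    empty, \<open>v\<close> is merely a reference point.\<close>
  define w where "w k = (Suc v + k) mod N" for k
  have w_less: "w k < N" for k using N by (simp add: w_def)
  have w_last: "Suc k = N" if "k < N" "w k = v" for k
    using that v(1) by (cases "Suc v + k < N") (auto simp: w_def le_mod_geq)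
  have w_surj: "\<exists>k<N. x = w k" if "x < N" for x
  proof (intro exI conjI)
    have "w ((x + (N - Suc v)) mod N) = (Suc v + (x + (N - Suc v))) mod N"
      by (simp only: w_def mod_add_right_eq)
    also have "Suc v + (x + (N - Suc v)) = x + N" using v(1) by simp
    finally show "x = w ((x + (N - Suc v)) mod N)" using that by simp
    show "(x + (N - Suc v)) mod N < N" using that by simp
  qed
  have step: "(w k, w (Suc k)) \<in> ?R" if "w k \<notin> X" "w (Suc k) \<notin> X" for k
  proof -
    have "w (Suc k) = Suc (w k) mod N" by (simp add: w_def mod_Suc_eq)
    then show ?thesis using cycle[OF w_less[of k]] that by (simp add: delete_verts_def)
  qed
  have reach: "(w 0, w k) \<in> ?R\<^sup>*" if "k < N" "w k \<notin> X" for k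
    using that
  proof (induction k)
    case (Suc k)
    then have "w k \<notin> X" using w_last[of k] v(2) by auto
    then show ?case using Suc step[of k] by (auto intro: rtrancl.rtrancl_into_rtrancl)
  qed simp
  have sym: "sym (?R\<^sup>*)" by (rule sym_rtrancl) (auto intro: symI simp: insert_commute)
  show "connected_graph (delete_verts H X)"
    unfolding connected_graph_def
  proof (intro conjI ballI)
    have "w 0 \<notin> X" using w_last[of 0] v(2) N by auto
    then show "verts (delete_verts H X) \<noteq> {}" using w_less N(1) by (auto simp: delete_verts_def)
    fix x y assume "x \<in> verts (delete_verts H X)" "y \<in> verts (delete_verts H X)"
    then have "(w 0, x) \<in> ?R\<^sup>*" "(w 0, y) \<in> ?R\<^sup>*"
      using w_surj reach N(1) by (auto simp: delete_verts_def)
    then show "(x, y) \<in> ?R\<^sup>*" using sym by (meson symD rtrancl_trans)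
  qed
qed

lemma k_connected_G: "k_connected 2 (G n)"
proof (rule hamiltonian_2_connected)
  show "verts (G n) = {..<2 * n + 15}" "3 \<le> 2 * n + 15" by (simp_all add: G_def)
  fix i assume i: "i < 2 * n + 15"
  show "{i, Suc i mod (2 * n + 15)} \<in> edges (G n)"
  proof (cases "13 \<le> i")
    case True
    have "Suc i mod (2 * n + 15) = next_vertex n i"
    proof (cases "i = 2 * n + 14")
      case True
      then have "Suc i = 2 * n + 15" by simp
      show ?thesis unfolding \<open>Suc i = 2 * n + 15\<close> by (simp add: next_vertex_def True)
    qed (use i in \<open>simp add: next_vertex_def\<close>)
    then show ?thesis using i True by (auto simp: G_def)
  next
    case False
    then have "i = 0 \<or> i = 1 \<or> i = 2 \<or> i = 3 \<or> i = 4 \<or> i = 5 \<or> i = 6 \<or> i = 7 \<or> i = 8 \<or> i = 9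
      \<or> i = 10 \<or> i = 11 \<or> i = 12" by presburger
    then show ?thesis by (elim disjE) (simp_all add: G_def blocks_def block1_def block2_def numeral_2_eq_2[symmetric])
  qed
qed

theorem theorem5:
  "\<exists>S :: nat graph set. infinite S \<and>
     (\<forall>G\<in>S. \<forall>H\<in>S. G \<noteq> H \<longrightarrow> \<not> graph_iso G H) \<and>
     (\<forall>G\<in>S. simple_graph G \<and> k_connected 2 G \<and> max_degree G = 5 \<and>
        circular_chromatic_index G = 5 + 2 / 3)"
proof (intro exI conjI ballI impI)
  have card: "card (verts (G n)) = 2 * n + 15" for n by (simp add: G_def)
  then have "inj G" by (metis (no_types) injI add_right_cancel mult_cancel1 zero_neq_numeral)
  then show "infinite (range G)" by (simp add: finite_image_iff)
  \<comment> \<open>Different members of the family have different numbers of vertices.\<close>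
  show "\<not> graph_iso A B" if "A \<in> range G" "B \<in> range G" "A \<noteq> B" for A B
  proof
    assume "graph_iso A B"
    then have "card (verts A) = card (verts B)" by (auto simp: graph_iso_def bij_betw_same_card)
    with that card show False by auto
  qed
  fix A assume "A \<in> range G"
  then obtain n where "A = G n" by blast
  then show "simple_graph A" "k_connected 2 A" "max_degree A = 5" "circular_chromatic_index A = 5 + 2 / 3"
    by (simp_all add: simple_graph_G k_connected_G max_degree_G circular_chromatic_index_G)
qed

end
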